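(* Let $A$ and $B$ be unital complex Banach algebras which are homotopy equivalent. Then $\mathrm{csr}\,A=\mathrm{csr}\,B$ and $\mathrm{gsr}\,A=\mathrm{gsr}\,B$.
   Context: Morphisms of Banach algebras are continuous unital algebra homomorphisms. Two morphisms $\phi_0,\phi_1:A\to B$ are homotopic if they are the endpoints of a family of morphisms $\{\phi_t\}_{0\le t\le 1}:A\to B$ such that $t\mapsto\phi_t(a)$ is continuous for each $a\in A$. $A$ and $B$ are homotopy equivalent if there are morphisms $\phi:A\to B$ and $\psi:B\to A$ with $\psi\phi$ homotopic to $\mathrm{id}_A$ and $\phi\psi$ homotopic to $\mathrm{id}_B$. For a unital Banach algebra $A$ and $m\ge 1$, $\mathrm{Lg}_m(A)=\{(a_1,\dots,a_m)\in A^m : Aa_1+\dots+Aa_m=A\}$. The group $\mathrm{GL}_m(A)$ acts on $\mathrm{Lg}_m(A)$ by $\underline{a}\mapsto \alpha\cdot\underline{a}^T$ (matrix times column vector), and $\mathrm{GL}_m^0(A)$ denotes the connected component of the identity in $\mathrm{GL}_m(A)$. The connected stable rank $\mathrm{csr}\,A$ is the least $n\ge 1$ such that $\mathrm{GL}_m^0(A)$ acts transitively on $\mathrm{Lg}_m(A)$ for all $m\ge n$ (equivalently, $\mathrm{Lg}_m(A)$ is connected for all $m\ge n$). The general stable rank $\mathrm{gsr}\,A$ is the least $n\ge1$ such that $\mathrm{GL}_m(A)$ acts transitively on $\mathrm{Lg}_m(A)$ for all $m\ge n$ (equivalently, for all $m\ge n$, any right $A$-module $P$ with $P\oplus A\simeq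 A^m$ satisfies $P\simeq A^{m-1}$). Each rank is set to be $\infty$ if no such $n$ exists. *)

theory Defs
  imports "HOL-Analysis.Analysis" "HOL-Library.Extended_Nat"
begin

text \<open>
  Unital complex Banach algebras. The inherited class real_normed_algebra gives the
  submultiplicative norm. Building on it and monoid_mult, rather than on
  real_normed_algebra_1, imposes neither \<open>norm 1 = 1\<close> nor \<open>0 \<noteq> 1\<close>.
\<close>

class complex_banach_algebra_1 = real_normed_algebra + monoid_mult + banach +
  fixes scaleC :: "complex \<Rightarrow> 'a \<Rightarrow> 'a"  (infixr "*\<^sub>C" 75)
  assumes scaleC_add_right: "c *\<^sub>C (x + y) = c *\<^sub>C x + c *\<^sub>C y"
    and scaleC_add_left: "(c + d) *\<^sub>C x = c *\<^sub>C x + d *\<^sub>C x"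
    and scaleC_scaleC: "c *\<^sub>C d *\<^sub>C x = (c * d) *\<^sub>C x"
    and scaleC_of_real: "complex_of_real r *\<^sub>C x = r *\<^sub>R x"
    and mult_scaleC_left: "(c *\<^sub>C x) * y = c *\<^sub>C (x * y)"
    and mult_scaleC_right: "x * (c *\<^sub>C y) = c *\<^sub>C (x * y)"
    and norm_scaleC: "norm (c *\<^sub>C x) = cmod c * norm x"

definition banach_morphism ::
    "('a::complex_banach_algebra_1 \<Rightarrow> 'b::complex_banach_algebra_1) \<Rightarrow> bool" where
  "banach_morphism f \<longleftrightarrow>
     (\<forall>x y. f (x + y) = f x + f y) \<and>
     (\<forall>c x. f (c *\<^sub>C x) = c *\<^sub>C f x) \<and>
     (\<forall>x y. f (x * y) = f x * f y) \<and>
     f 1 = 1 \<and>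
     continuous_on UNIV f"

definition homotopic_morphisms ::
    "('a::complex_banach_algebra_1 \<Rightarrow> 'b::complex_banach_algebra_1) \<Rightarrow> ('a \<Rightarrow> 'b) \<Rightarrow> bool" where
  "homotopic_morphisms f g \<longleftrightarrow>
     (\<exists>h :: real \<Rightarrow> 'a \<Rightarrow> 'b.
        (\<forall>t\<in>{0..1}. banach_morphism (h t)) \<and>
        (\<forall>a. continuous_on {0..1} (\<lambda>t. h t a)) \<and>
        h 0 = f \<and> h 1 = g)"

definition homotopy_equivalent_algebras ::
    "'a::complex_banach_algebra_1 itself \<Rightarrow> 'b::complex_banach_algebra_1 itself \<Rightarrow> bool" where
  "homotopy_equivalent_algebras A B \<longleftrightarrow>
     (\<exists>(f :: 'a \<Rightarrow> 'b) (g :: 'b \<Rightarrow> 'a).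
        banach_morphism f \<and> banach_morphism g \<and>
        homotopic_morphisms (g \<circ> f) id \<and> homotopic_morphisms (f \<circ> g) id)"

text \<open>
  Since the size \<open>m\<close> is quantified over, an element of \<open>A\<^sup>m\<close> is a function on nat vanishing
  outside \<open>{..<m}\<close>, and an \<open>m \<times> m\<close> matrix is a binary function on nat vanishing outside
  \<open>{..<m} \<times> {..<m}\<close>. The topology is the product topology carried by function types; on
  these finitely supported families it is the norm topology of \<open>A\<^sup>m\<close> and of \<open>M\<^sub>m(A)\<close>.
\<close>

definition tuples :: "nat \<Rightarrow> (nat \<Rightarrow> 'a::zero) set" where
  "tuples m = {a. \<forall>i. i \<ge> m \<longrightarrow> a i = 0}"

definition square_matrices :: "nat \<Rightarrow> (nat \<Rightarrow> nat \<Rightarrow> 'a::zero) set" where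
  "square_matrices m = {\<alpha>. \<forall>i j. i \<ge> m \<or> j \<ge> m \<longrightarrow> \<alpha> i j = 0}"

definition one_matrix :: "nat \<Rightarrow> nat \<Rightarrow> nat \<Rightarrow> 'a::{zero,one}" where
  "one_matrix m = (\<lambda>i j. if i = j \<and> i < m then 1 else 0)"

definition matrix_times ::
    "nat \<Rightarrow> (nat \<Rightarrow> nat \<Rightarrow> 'a) \<Rightarrow> (nat \<Rightarrow> nat \<Rightarrow> 'a) \<Rightarrow> nat \<Rightarrow> nat \<Rightarrow> 'a::semiring_0" where
  "matrix_times m \<alpha> \<beta> = (\<lambda>i j. \<Sum>k<m. \<alpha> i k * \<beta> k j)"

definition matrix_act :: "nat \<Rightarrow> (nat \<Rightarrow> nat \<Rightarrow> 'a) \<Rightarrow> (nat \<Rightarrow> 'a) \<Rightarrow> nat \<Rightarrow> 'a::semiring_0" where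
  "matrix_act m \<alpha> a = (\<lambda>i. \<Sum>j<m. \<alpha> i j * a j)"

definition GL :: "nat \<Rightarrow> (nat \<Rightarrow> nat \<Rightarrow> 'a::complex_banach_algebra_1) set" where
  "GL m = {\<alpha> \<in> square_matrices m. \<exists>\<beta> \<in> square_matrices m.
             matrix_times m \<alpha> \<beta> = one_matrix m \<and> matrix_times m \<beta> \<alpha> = one_matrix m}"

definition GL0 :: "nat \<Rightarrow> (nat \<Rightarrow> nat \<Rightarrow> 'a::complex_banach_algebra_1) set" where
  "GL0 m = connected_component_set (GL m) (one_matrix m)"

definition Lg :: "nat \<Rightarrow> (nat \<Rightarrow> 'a::complex_banach_algebra_1) set" where
  "Lg m = {a \<in> tuples m. {\<Sum>i<m. x i * a i | x. x \<in> tuples m} = UNIV}"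

definition acts_transitively ::
    "nat \<Rightarrow> (nat \<Rightarrow> nat \<Rightarrow> 'a::complex_banach_algebra_1) set \<Rightarrow> (nat \<Rightarrow> 'a) set \<Rightarrow> bool" where
  "acts_transitively m G X \<longleftrightarrow> (\<forall>a\<in>X. \<forall>b\<in>X. \<exists>\<alpha>\<in>G. matrix_act m \<alpha> a = b)"

text \<open>
  The infimum of a nonempty set in enat is its least element, and that of the empty set
  is \<open>\<infinity>\<close>.
\<close>

definition csr :: "'a::complex_banach_algebra_1 itself \<Rightarrow> enat" where
  "csr A = Inf {enat n | n. n \<ge> 1 \<and>
     (\<forall>m\<ge>n. acts_transitively m (GL0 m) (Lg m :: (nat \<Rightarrow> 'a) set))}"

definition gsr :: "'a::complex_banach_algebra_1 itself \<Rightarrow> enat" where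
  "gsr A = Inf {enat n | n. n \<ge> 1 \<and>
     (\<forall>m\<ge>n. acts_transitively m (GL m) (Lg m :: (nat \<Rightarrow> 'a) set))}"

end

theory Submission imports Defs begin

text \<open>
  Write \<open>f : A \<rightarrow> B\<close> and \<open>g : B \<rightarrow> A\<close> for the two morphisms of the equivalence. For every single
  size \<open>m\<close>, transitivity of the action on \<open>Lg\<^sub>m(A)\<close> passes to \<open>Lg\<^sub>m(B)\<close> along the
  homotopy from \<open>fg\<close> to \<open>id\<^sub>B\<close>, and by symmetry the converse holds. Given \<open>a\<close> and \<open>b\<close> in
  \<open>Lg\<^sub>m(B)\<close>, transitivity over \<open>A\<close> yields \<open>\<alpha>\<close> with \<open>\<alpha> g(a) = g(b)\<close>, hence
  \<open>f(\<alpha>) fg(a) = fg(b)\<close>, and \<open>f(\<alpha>)\<close> lies in \<open>GL\<close> or \<open>GL\<^sup>0\<close> as \<open>\<alpha>\<close> does.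
  The homotopy traces paths inside \<open>Lg\<^sub>m(B)\<close> from \<open>fg(a)\<close> to \<open>a\<close> and from \<open>fg(b)\<close> to \<open>b\<close>, so it
  remains to see that the ends of a path in \<open>Lg\<^sub>m(B)\<close> lie in one orbit of \<open>GL\<^sup>0\<close>.

  This holds because the orbits of \<open>GL\<^sup>0\<close> in \<open>Lg\<^sub>m(B)\<close> are open
  (lemma \<open>GL0_reachable_near\<close>). If \<open>b \<cdot> a = 1\<close>, the rank one perturbation
  \<open>1 + (a' - a) b\<^sup>T\<close> of the identity carries \<open>a\<close> to \<open>a'\<close>. Such a matrix \<open>1 + x b\<^sup>T\<close> is
  invertible as soon as the single element \<open>1 + b \<cdot> x\<close> of the algebra is, by the
  Sherman--Morrison formula; for \<open>x\<close> small this, together with the segment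
  \<open>1 + s x b\<^sup>T\<close>, puts the matrix in \<open>GL\<^sup>0\<close>. Thus invertibility near the identity is needed only
  in the algebra itself, never in the algebra of matrices.
\<close>

section \<open>Invertible elements near the identity\<close>

text \<open>
  The inverse is \<open>1 - z\<close> where \<open>z\<close> is the fixed point of the contraction \<open>z \<mapsto> y - y z\<close>. Unlike
  the geometric series, this does not involve the norm of \<open>1\<close>, which may differ from 1.
\<close>

lemma near_one_invertible:
  fixes y :: "'a::complex_banach_algebra_1"
  assumes "norm y < 1"
  obtains c where "(1 + y) * c = 1" "c * (1 + y) = 1"
proof -
  have "dist (y - y * u) (y - y * v) \<le> norm y * dist u v" for u v
    using norm_mult_ineq[of y "v - u"]
    by (simp add: dist_norm right_diff_distrib norm_minus_commute)
  then obtain z where z: "y - y * z = z"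
    using banach_fix_type[of "norm y" "\<lambda>z. y - y * z"] assms by auto
  have "dist (y - u * y) (y - v * y) \<le> norm y * dist u v" for u v
    using norm_mult_ineq[of "v - u" y]
    by (simp add: dist_norm left_diff_distrib norm_minus_commute mult.commute[of "norm y"])
  then obtain w where w: "y - w * y = w"
    using banach_fix_type[of "norm y" "\<lambda>w. y - w * y"] assms by auto
  have r: "(1 + y) * (1 - z) = 1"
    using z by (simp add: algebra_simps)
  have l: "(1 - w) * (1 + y) = 1"
    using w by (simp add: algebra_simps)
  have "1 - w = 1 - z"
    using r l by (metis mult.assoc mult_1_left mult_1_right)
  with r l that show thesis by metis
qed

section \<open>Matrices over a Banach algebra\<close>

lemma tuples_eq_0: "a \<in> tuples m \<Longrightarrow> \<not> i < m \<Longrightarrow> a i = 0"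
  by (simp add: tuples_def)

lemma sum_one_matrix_left:
  "(\<Sum>k<m. one_matrix m i k * g k) = (if i < m then g i else (0::'a::complex_banach_algebra_1))"
proof -
  have "(\<Sum>k<m. one_matrix m i k * g k) = (\<Sum>k<m. if i = k then g k else 0)"
    by (rule sum.cong) (auto simp: one_matrix_def)
  then show ?thesis by simp
qed

lemma sum_one_matrix_right:
  "(\<Sum>k<m. g k * one_matrix m k j) = (if j < m then g j else (0::'a::complex_banach_algebra_1))"
proof -
  have "(\<Sum>k<m. g k * one_matrix m k j) = (\<Sum>k<m. if k = j then g k else 0)"
    by (rule sum.cong) (auto simp: one_matrix_def)
  then show ?thesis by simp
qed

lemma matrix_times_assoc:
  "matrix_times m (matrix_times m \<alpha> \<beta>) \<gamma> = matrix_times m \<alpha> (matrix_times m \<beta> \<gamma>)"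
proof (intro ext)
  fix i j
  have "(\<Sum>k<m. \<Sum>l<m. \<alpha> i l * \<beta> l k * \<gamma> k j) = (\<Sum>l<m. \<Sum>k<m. \<alpha> i l * \<beta> l k * \<gamma> k j)"
    by (rule sum.swap)
  then show "matrix_times m (matrix_times m \<alpha> \<beta>) \<gamma> i j = matrix_times m \<alpha> (matrix_times m \<beta> \<gamma>) i j"
    by (simp add: matrix_times_def sum_distrib_left sum_distrib_right mult.assoc)
qed

lemma matrix_act_times:
  "matrix_act m (matrix_times m \<alpha> \<beta>) a = matrix_act m \<alpha> (matrix_act m \<beta> a)"
proof
  fix i
  have "(\<Sum>k<m. \<Sum>l<m. \<alpha> i l * \<beta> l k * a k) = (\<Sum>l<m. \<Sum>k<m. \<alpha> i l * \<beta> l k * a k)"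
    by (rule sum.swap)
  then show "matrix_act m (matrix_times m \<alpha> \<beta>) a i = matrix_act m \<alpha> (matrix_act m \<beta> a) i"
    by (simp add: matrix_times_def matrix_act_def sum_distrib_left sum_distrib_right mult.assoc)
qed

lemma one_matrix_square: "one_matrix m \<in> square_matrices m"
  by (simp add: one_matrix_def square_matrices_def)

lemma matrix_times_square:
  "\<alpha> \<in> square_matrices m \<Longrightarrow> \<beta> \<in> square_matrices m \<Longrightarrow> matrix_times m \<alpha> \<beta> \<in> square_matrices m"
  by (auto simp: square_matrices_def matrix_times_def)

lemma matrix_times_one_left:
  fixes \<alpha> :: "nat \<Rightarrow> nat \<Rightarrow> 'a::complex_banach_algebra_1"
  assumes "\<alpha> \<in> square_matrices m"
  shows "matrix_times m (one_matrix m) \<alpha> = \<alpha>"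
  using assms
  by (intro ext) (auto simp: matrix_times_def sum_one_matrix_left square_matrices_def)

lemma matrix_times_one_right:
  fixes \<alpha> :: "nat \<Rightarrow> nat \<Rightarrow> 'a::complex_banach_algebra_1"
  assumes "\<alpha> \<in> square_matrices m"
  shows "matrix_times m \<alpha> (one_matrix m) = \<alpha>"
  using assms
  by (intro ext) (auto simp: matrix_times_def sum_one_matrix_right square_matrices_def)

lemma GL_square: "\<alpha> \<in> GL m \<Longrightarrow> \<alpha> \<in> square_matrices m"
  by (simp add: GL_def)

lemma one_in_GL: "one_matrix m \<in> GL m"
  by (auto simp: GL_def one_matrix_square matrix_times_one_left intro!: bexI[of _ "one_matrix m"])

lemma GL_times:
  assumes "\<alpha> \<in> GL m" "\<beta> \<in> GL m"
  shows "matrix_times m \<alpha> \<beta> \<in> GL m"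
proof -
  obtain \<alpha>' where \<alpha>: "\<alpha> \<in> square_matrices m" "\<alpha>' \<in> square_matrices m"
      "matrix_times m \<alpha> \<alpha>' = one_matrix m" "matrix_times m \<alpha>' \<alpha> = one_matrix m"
    using assms(1) by (auto simp: GL_def)
  obtain \<beta>' where \<beta>: "\<beta> \<in> square_matrices m" "\<beta>' \<in> square_matrices m"
      "matrix_times m \<beta> \<beta>' = one_matrix m" "matrix_times m \<beta>' \<beta> = one_matrix m"
    using assms(2) by (auto simp: GL_def)
  have "matrix_times m (matrix_times m \<alpha> \<beta>) (matrix_times m \<beta>' \<alpha>') = one_matrix m"
    using \<alpha> \<beta> by (metis matrix_times_assoc matrix_times_one_left)
  moreover have "matrix_times m (matrix_times m \<beta>' \<alpha>') (matrix_times m \<alpha> \<beta>) = one_matrix m"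
    using \<alpha> \<beta> by (metis matrix_times_assoc matrix_times_one_left)
  ultimately show ?thesis
    using \<alpha> \<beta> matrix_times_square unfolding GL_def by blast
qed

lemma one_in_GL0: "one_matrix m \<in> GL0 m"
  by (simp add: GL0_def one_in_GL)

lemma GL0_subset_GL: "GL0 m \<subseteq> GL m"
  by (simp add: GL0_def connected_component_subset)

lemma connected_GL0: "connected (GL0 m)"
  by (simp add: GL0_def)

lemma GL0_I:
  assumes "connected C" "C \<subseteq> GL m" "\<beta> \<in> C" "\<beta> \<in> GL0 m" "\<alpha> \<in> C"
  shows "\<alpha> \<in> GL0 m"
proof -
  have "C \<subseteq> connected_component_set (GL m) \<beta>"
    using assms by (intro connected_component_maximal)
  also have "\<dots> = GL0 m"
    using assms(4) by (metis GL0_def connected_component_eq)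
  finally show ?thesis using assms(5) by blast
qed

lemma continuous_on_matrixI:
  fixes F :: "'c::topological_space \<Rightarrow> nat \<Rightarrow> nat \<Rightarrow> 'b::topological_space"
  assumes "\<And>i j. continuous_on S (\<lambda>x. F x i j)"
  shows "continuous_on S F"
  using assms by (intro continuous_on_coordinatewise_then_product)

lemma continuous_on_entry:
  "continuous_on S (\<lambda>\<alpha> :: nat \<Rightarrow> nat \<Rightarrow> 'a::topological_space. \<alpha> i j)"
  by (rule continuous_on_subset[OF continuous_on_product_then_coordinatewise
        [OF continuous_on_product_coordinates] subset_UNIV])

text \<open>
  The translate of the identity component by \<open>\<alpha>\<close> is connected and contains \<open>\<alpha>\<close>, so it stays in
  the component of \<open>\<alpha>\<close>.
\<close>

lemma GL0_times:
  assumes "\<alpha> \<in> GL0 m" "\<beta> \<in> GL0 m"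
  shows "matrix_times m \<alpha> \<beta> \<in> GL0 m"
proof (rule GL0_I)
  have "continuous_on (GL0 m) (matrix_times m \<alpha>)"
    unfolding matrix_times_def
    by (intro continuous_on_matrixI continuous_intros continuous_on_entry)
  then show "connected (matrix_times m \<alpha> ` GL0 m)"
    by (intro connected_continuous_image connected_GL0)
  show "matrix_times m \<alpha> ` GL0 m \<subseteq> GL m"
    using assms GL0_subset_GL GL_times by blast
  have "matrix_times m \<alpha> (one_matrix m) = \<alpha>"
    using assms(1) GL0_subset_GL GL_square matrix_times_one_right by blast
  then show "\<alpha> \<in> matrix_times m \<alpha> ` GL0 m"
    using one_in_GL0 by (metis image_eqI)
  show "matrix_times m \<alpha> \<beta> \<in> matrix_times m \<alpha> ` GL0 m"
    using assms(2) by (rule imageI)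
qed (rule assms)

section \<open>Orbits of the identity component\<close>

lemma Lg_iff:
  "a \<in> Lg m \<longleftrightarrow> a \<in> tuples m \<and> (\<exists>b\<in>tuples m. (\<Sum>i<m. b i * a i) = 1)"
proof -
  have "{\<Sum>i<m. x i * a i | x. x \<in> tuples m} = UNIV"
    if b: "b \<in> tuples m" "(\<Sum>i<m. b i * a i) = 1" for b
  proof -
    have "\<exists>x\<in>tuples m. c = (\<Sum>i<m. x i * a i)" for c
      using b by (intro bexI[of _ "\<lambda>i. c * b i"])
                 (auto simp: tuples_def mult.assoc sum_distrib_left[symmetric])
    then show ?thesis by blast
  qed
  moreover have "\<exists>b\<in>tuples m. (\<Sum>i<m. b i * a i) = 1"
    if "{\<Sum>i<m. x i * a i | x. x \<in> tuples m} = UNIV"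
  proof -
    have "1 \<in> {\<Sum>i<m. x i * a i | x. x \<in> tuples m}"
      using that by simp
    then show ?thesis by force
  qed
  ultimately show ?thesis
    by (auto simp: Lg_def)
qed

text \<open>The matrix \<open>1 + x b\<^sup>T\<close> for a column \<open>x\<close> and a row \<open>b\<close>.\<close>

definition rank_one_perturbation ::
    "nat \<Rightarrow> (nat \<Rightarrow> 'a) \<Rightarrow> (nat \<Rightarrow> 'a) \<Rightarrow> nat \<Rightarrow> nat \<Rightarrow> 'a::complex_banach_algebra_1" where
  "rank_one_perturbation m x b = (\<lambda>i j. one_matrix m i j + x i * b j)"

lemma rank_one_perturbation_square:
  assumes "x \<in> tuples m" "b \<in> tuples m"
  shows "rank_one_perturbation m x b \<in> square_matrices m"
  using assms
  by (auto simp: rank_one_perturbation_def square_matrices_def one_matrix_def tuples_def)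

lemma rank_one_perturbation_times:
  assumes "x \<in> tuples m" "y \<in> tuples m" "b \<in> tuples m"
  shows "matrix_times m (rank_one_perturbation m x b) (rank_one_perturbation m y b) =
           rank_one_perturbation m (\<lambda>i. x i + y i + x i * (\<Sum>k<m. b k * y k)) b"
proof (intro ext)
  fix i j
  have "matrix_times m (rank_one_perturbation m x b) (rank_one_perturbation m y b) i j =
      (\<Sum>k<m. one_matrix m i k * (one_matrix m k j + y k * b j)) +
      x i * ((\<Sum>k<m. b k * one_matrix m k j) + (\<Sum>k<m. b k * y k) * b j)"
    by (simp add: matrix_times_def rank_one_perturbation_def distrib_left distrib_right
                  sum.distrib sum_distrib_left sum_distrib_right mult.assoc)
  also have "\<dots> = rank_one_perturbation m (\<lambda>i. x i + y i + x i * (\<Sum>k<m. b k * y k)) b i j"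
    using assms unfolding sum_one_matrix_left sum_one_matrix_right
    by (auto simp: rank_one_perturbation_def tuples_eq_0 one_matrix_def algebra_simps)
  finally show "matrix_times m (rank_one_perturbation m x b) (rank_one_perturbation m y b) i j = \<dots>" .
qed

text \<open>
  Sherman--Morrison: with \<open>c = (1 + b \<cdot> x)\<^sup>-\<^sup>1\<close>, the inverse of \<open>1 + x b\<^sup>T\<close> is \<open>1 - x c b\<^sup>T\<close>.
\<close>

lemma rank_one_perturbation_GL:
  assumes x: "x \<in> tuples m" and b: "b \<in> tuples m"
    and small: "norm (\<Sum>k<m. b k * x k) < 1"
  shows "rank_one_perturbation m x b \<in> GL m"
proof -
  define y where "y = (\<Sum>k<m. b k * x k)"
  obtain c where c: "(1 + y) * c = 1" "c * (1 + y) = 1"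
    using near_one_invertible small unfolding y_def by blast
  define x' where "x' = (\<lambda>i. - (x i * c))"
  have x': "x' \<in> tuples m"
    using x by (simp add: x'_def tuples_def)
  have one: "rank_one_perturbation m (\<lambda>i. 0) b = one_matrix m"
    by (simp add: rank_one_perturbation_def)
  have y': "(\<Sum>k<m. b k * x' k) = - (y * c)"
    by (simp add: x'_def y_def sum_negf sum_distrib_right mult.assoc)
  have "x i + x' i + x i * (\<Sum>k<m. b k * x' k) = x i * (1 - (1 + y) * c)" for i
    unfolding y' by (simp add: x'_def algebra_simps)
  then have 1: "matrix_times m (rank_one_perturbation m x b) (rank_one_perturbation m x' b) = one_matrix m"
    by (simp add: rank_one_perturbation_times x x' b c one)
  have "x' i + x i + x' i * (\<Sum>k<m. b k * x k) = x i * (1 - c * (1 + y))" for i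
    unfolding y_def[symmetric] by (simp add: x'_def algebra_simps)
  then have 2: "matrix_times m (rank_one_perturbation m x' b) (rank_one_perturbation m x b) = one_matrix m"
    by (simp add: rank_one_perturbation_times x x' b c one)
  show ?thesis
    using 1 2 x x' b rank_one_perturbation_square unfolding GL_def by blast
qed

text \<open>The segment \<open>1 + s x b\<^sup>T\<close>, \<open>0 \<le> s \<le> 1\<close>, joins the matrix to the identity inside \<open>GL\<close>.\<close>

lemma rank_one_perturbation_GL0:
  assumes x: "x \<in> tuples m" and b: "b \<in> tuples m"
    and small: "norm (\<Sum>k<m. b k * x k) < 1"
  shows "rank_one_perturbation m x b \<in> GL0 m"
proof (rule GL0_I)
  define P where "P = (\<lambda>s::real. rank_one_perturbation m (\<lambda>i. s *\<^sub>R x i) b)"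
  have "continuous_on {0..1} P"
    unfolding P_def rank_one_perturbation_def
    by (intro continuous_on_matrixI continuous_intros)
  then show "connected (P ` {0..1})"
    by (intro connected_continuous_image) auto
  have "P s \<in> GL m" if s: "s \<in> {0..1}" for s
    unfolding P_def
  proof (rule rank_one_perturbation_GL)
    have "norm (\<Sum>k<m. b k * s *\<^sub>R x k) = s * norm (\<Sum>k<m. b k * x k)"
      using s by (simp add: scaleR_sum_right[symmetric])
    also have "\<dots> \<le> norm (\<Sum>k<m. b k * x k)"
      using s by (simp add: mult_left_le_one_le)
    finally show "norm (\<Sum>k<m. b k * s *\<^sub>R x k) < 1"
      using small by simp
  qed (use x b in \<open>auto simp: tuples_def\<close>)
  then show "P ` {0..1} \<subseteq> GL m" by blast
  have "P 0 = one_matrix m"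
    by (simp add: P_def rank_one_perturbation_def)
  then show "one_matrix m \<in> P ` {0..1}"
    by (metis atLeastAtMost_iff image_eqI order_refl zero_le_one)
  have "P 1 = rank_one_perturbation m x b"
    by (simp add: P_def)
  then show "rank_one_perturbation m x b \<in> P ` {0..1}"
    by (metis atLeastAtMost_iff image_eqI order_refl zero_le_one)
qed (rule one_in_GL0)

lemma rank_one_perturbation_act:
  assumes "a \<in> tuples m" "a' \<in> tuples m" "(\<Sum>k<m. b k * a k) = 1"
  shows "matrix_act m (rank_one_perturbation m (\<lambda>i. a' i - a i) b) a = a'"
proof
  fix i
  have "matrix_act m (rank_one_perturbation m (\<lambda>i. a' i - a i) b) a i =
      (\<Sum>k<m. one_matrix m i k * a k) + (a' i - a i) * (\<Sum>k<m. b k * a k)"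
    by (simp add: matrix_act_def rank_one_perturbation_def distrib_right sum.distrib
                  sum_distrib_left mult.assoc)
  also have "\<dots> = a' i"
    using assms by (simp add: sum_one_matrix_left tuples_eq_0)
  finally show "matrix_act m (rank_one_perturbation m (\<lambda>i. a' i - a i) b) a i = a' i" .
qed

definition GL0_reachable :: "nat \<Rightarrow> (nat \<Rightarrow> 'a::complex_banach_algebra_1) \<Rightarrow> (nat \<Rightarrow> 'a) \<Rightarrow> bool" where
  "GL0_reachable m a a' \<longleftrightarrow> (\<exists>\<alpha>\<in>GL0 m. matrix_act m \<alpha> a = a')"

lemma GL0_reachable_trans:
  "GL0_reachable m a b \<Longrightarrow> GL0_reachable m b c \<Longrightarrow> GL0_reachable m a c"
  unfolding GL0_reachable_def by (auto simp: matrix_act_times[symmetric] intro: GL0_times)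

text \<open>
  Openness of the orbits. The return from \<open>a'\<close> to \<open>a\<close> uses the same construction with the row
  \<open>c b\<close>, \<open>c = (1 + b \<cdot> (a' - a))\<^sup>-\<^sup>1\<close>, which is dual to \<open>a'\<close>; so
  reachability is locally symmetric by construction.
\<close>

lemma GL0_reachable_near:
  assumes a: "a \<in> tuples m" and a': "a' \<in> tuples m" and b: "b \<in> tuples m"
    and dual: "(\<Sum>k<m. b k * a k) = 1"
    and near: "norm (\<Sum>k<m. b k * (a' k - a k)) < 1 / 2"
  shows "GL0_reachable m a a' \<and> GL0_reachable m a' a"
proof
  have diff: "(\<lambda>i. a' i - a i) \<in> tuples m" "(\<lambda>i. a i - a' i) \<in> tuples m"
    using a a' by (auto simp: tuples_def)
  have "rank_one_perturbation m (\<lambda>i. a' i - a i) b \<in> GL0 m"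
    using near by (intro rank_one_perturbation_GL0 diff b) simp
  then show "GL0_reachable m a a'"
    using rank_one_perturbation_act[OF a a' dual] unfolding GL0_reachable_def by blast
  define y where "y = (\<Sum>k<m. b k * (a' k - a k))"
  have y: "norm y < 1 / 2"
    using near by (simp add: y_def)
  then obtain c where c: "c * (1 + y) = 1" "(1 + y) * c = 1"
    using near_one_invertible[of y] by auto
  define b' where "b' = (\<lambda>i. c * b i)"
  have b': "b' \<in> tuples m"
    using b by (simp add: b'_def tuples_def)
  have "(\<Sum>k<m. b k * a' k) = 1 + y"
    using dual by (simp add: y_def right_diff_distrib sum_subtractf)
  then have dual': "(\<Sum>k<m. b' k * a' k) = 1"
    using c by (simp add: b'_def mult.assoc sum_distrib_left[symmetric])
  define z where "z = c * y"
  \<comment> \<open>\<open>z = y - y z\<close> gives \<open>norm z \<le> norm y / (1 - norm y) < 1\<close>; this is where the bound 1/2 enters.\<close>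
  have "(1 + y) * z = y"
    using c by (simp add: z_def mult.assoc[symmetric])
  then have "z = y - y * z"
    by (simp add: algebra_simps)
  then have "norm z \<le> norm y + norm y * norm z"
    by (metis norm_triangle_ineq4 norm_mult_ineq add_left_mono order_trans)
  also have "\<dots> \<le> norm y + 1 / 2 * norm z"
    using y by (intro add_left_mono mult_right_mono) auto
  finally have z: "norm z < 1"
    using y by simp
  have "(\<Sum>k<m. b' k * (a k - a' k)) = - z"
    by (simp add: b'_def z_def y_def mult.assoc sum_distrib_left[symmetric]
                  sum_subtractf right_diff_distrib)
  then have "rank_one_perturbation m (\<lambda>i. a i - a' i) b' \<in> GL0 m"
    using z by (intro rank_one_perturbation_GL0 diff b') simp
  then show "GL0_reachable m a' a"
    using rank_one_perturbation_act[OF a' a dual'] unfolding GL0_reachable_def by blast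
qed

text \<open>
  Mutual reachability is an equivalence relation with open classes, and a connected set cannot
  be split into several such classes. On \<open>S\<close> the neighbourhood of \<open>p\<close> inside its class is cut
  out by the condition of the preceding lemma, for one fixed \<open>b\<close> with \<open>b \<cdot> p = 1\<close>.
\<close>

lemma connected_Lg_GL0_reachable:
  fixes S :: "(nat \<Rightarrow> 'a::complex_banach_algebra_1) set"
  assumes "connected S" "S \<subseteq> Lg m" "a \<in> S" "a' \<in> S"
  shows "GL0_reachable m a a'"
proof -
  have "GL0_reachable m a a' \<and> GL0_reachable m a' a"
  proof (rule connected_equivalence_relation[OF assms(1,3,4)])
    fix p assume p: "p \<in> S"
    then have "p \<in> Lg m" using assms(2) by blast
    then obtain b where b: "p \<in> tuples m" "b \<in> tuples m" "(\<Sum>k<m. b k * p k) = 1"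
      unfolding Lg_iff by blast
    define F where "F = (\<lambda>q. norm (\<Sum>k<m. b k * (q k - p k)))"
    have coord: "continuous_on S (\<lambda>q :: nat \<Rightarrow> 'a. q k)" for k
      by (rule continuous_on_subset[OF continuous_on_product_coordinates subset_UNIV])
    have "continuous_on S F"
      unfolding F_def by (intro continuous_intros coord)
    then have "openin (top_of_set S) (S \<inter> F -` {..<1/2})"
      by (intro continuous_openin_preimage_gen) auto
    moreover have "p \<in> S \<inter> F -` {..<1/2}"
      using p by (simp add: F_def)
    moreover have "GL0_reachable m p q \<and> GL0_reachable m q p" if q: "q \<in> S \<inter> F -` {..<1/2}" for q
    proof (rule GL0_reachable_near[OF b(1) _ b(2,3)])
      have "q \<in> Lg m" using q assms(2) by blast
      then show "q \<in> tuples m" by (simp add: Lg_def)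
      show "norm (\<Sum>k<m. b k * (q k - p k)) < 1 / 2"
        using q by (simp add: F_def)
    qed
    ultimately show "\<exists>T. openin (top_of_set S) T \<and> p \<in> T \<and>
        (\<forall>q\<in>T. GL0_reachable m p q \<and> GL0_reachable m q p)"
      by blast
  qed (blast intro: GL0_reachable_trans)+
  then show ?thesis ..
qed

section \<open>Morphisms acting entrywise\<close>

lemma
  assumes "banach_morphism f"
  shows morphism_add: "f (x + y) = f x + f y"
    and morphism_mult: "f (x * y) = f x * f y"
    and morphism_one: "f 1 = 1"
    and morphism_continuous: "continuous_on UNIV f"
  using assms by (auto simp: banach_morphism_def)

lemma morphism_zero:
  assumes "banach_morphism f" shows "f 0 = 0"
  using morphism_add[OF assms, of 0 0] by simp

lemma morphism_sum:
  assumes "banach_morphism f" shows "f (sum g S) = (\<Sum>i\<in>S. f (g i))"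
  by (induction S rule: infinite_finite_induct)
     (simp_all add: morphism_zero[OF assms] morphism_add[OF assms])

lemma morphism_Lg:
  assumes "banach_morphism f" "a \<in> Lg m"
  shows "(\<lambda>i. f (a i)) \<in> Lg m"
proof -
  obtain b where b: "a \<in> tuples m" "b \<in> tuples m" "(\<Sum>i<m. b i * a i) = 1"
    using assms(2) unfolding Lg_iff by blast
  have "(\<Sum>i<m. f (b i) * f (a i)) = f (\<Sum>i<m. b i * a i)"
    by (simp add: morphism_sum[OF assms(1)] morphism_mult[OF assms(1)])
  then have "(\<Sum>i<m. f (b i) * f (a i)) = 1"
    by (simp add: b morphism_one[OF assms(1)])
  moreover have "(\<lambda>i. f (b i)) \<in> tuples m" "(\<lambda>i. f (a i)) \<in> tuples m"
    using b by (auto simp: tuples_def morphism_zero[OF assms(1)])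
  ultimately show ?thesis
    unfolding Lg_iff by (intro conjI bexI[of _ "\<lambda>i. f (b i)"])
qed

lemma morphism_matrix_times:
  assumes "banach_morphism f"
  shows "(\<lambda>i j. f (matrix_times m \<alpha> \<beta> i j)) = matrix_times m (\<lambda>i j. f (\<alpha> i j)) (\<lambda>i j. f (\<beta> i j))"
  by (simp add: matrix_times_def morphism_sum[OF assms] morphism_mult[OF assms])

lemma morphism_matrix_act:
  assumes "banach_morphism f"
  shows "(\<lambda>i. f (matrix_act m \<alpha> a i)) = matrix_act m (\<lambda>i j. f (\<alpha> i j)) (\<lambda>i. f (a i))"
  by (simp add: matrix_act_def morphism_sum[OF assms] morphism_mult[OF assms])

lemma morphism_one_matrix:
  assumes "banach_morphism f"
  shows "(\<lambda>i j. f (one_matrix m i j)) = one_matrix m"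
  by (intro ext) (simp add: one_matrix_def morphism_one[OF assms] morphism_zero[OF assms])

lemma morphism_GL:
  assumes f: "banach_morphism f" and \<alpha>: "\<alpha> \<in> GL m"
  shows "(\<lambda>i j. f (\<alpha> i j)) \<in> GL m"
proof -
  obtain \<beta> where \<beta>: "\<beta> \<in> square_matrices m"
      "matrix_times m \<alpha> \<beta> = one_matrix m" "matrix_times m \<beta> \<alpha> = one_matrix m"
    using \<alpha> by (auto simp: GL_def)
  have "(\<lambda>i j. f (\<alpha> i j)) \<in> square_matrices m" "(\<lambda>i j. f (\<beta> i j)) \<in> square_matrices m"
    using GL_square[OF \<alpha>] \<beta> by (auto simp: square_matrices_def morphism_zero[OF f])
  moreover have "matrix_times m (\<lambda>i j. f (\<alpha> i j)) (\<lambda>i j. f (\<beta> i j)) = one_matrix m"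
    "matrix_times m (\<lambda>i j. f (\<beta> i j)) (\<lambda>i j. f (\<alpha> i j)) = one_matrix m"
    by (simp_all only: morphism_matrix_times[OF f, symmetric] \<beta> morphism_one_matrix[OF f])
  ultimately show ?thesis
    unfolding GL_def by blast
qed

lemma morphism_GL0:
  fixes f :: "'a::complex_banach_algebra_1 \<Rightarrow> 'b::complex_banach_algebra_1"
  assumes f: "banach_morphism f" and \<alpha>: "\<alpha> \<in> GL0 m"
  shows "(\<lambda>i j. f (\<alpha> i j)) \<in> GL0 m"
proof (rule GL0_I)
  define F where "F = (\<lambda>(\<beta> :: nat \<Rightarrow> nat \<Rightarrow> 'a) i j. f (\<beta> i j))"
  have "continuous_on (GL0 m) F"
    unfolding F_def
    by (intro continuous_on_matrixI continuous_on_compose2[OF morphism_continuous[OF f]]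
              continuous_on_entry) auto
  then show "connected (F ` GL0 m)"
    by (intro connected_continuous_image connected_GL0)
  show "F ` GL0 m \<subseteq> GL m"
    using GL0_subset_GL morphism_GL[OF f] by (auto simp: F_def)
  have "F (one_matrix m) = one_matrix m"
    by (simp add: F_def morphism_one_matrix[OF f])
  then show "one_matrix m \<in> F ` GL0 m"
    using one_in_GL0 by (metis image_eqI)
  show "(\<lambda>i j. f (\<alpha> i j)) \<in> F ` GL0 m"
    using \<alpha> by (auto simp: F_def)
qed (rule one_in_GL0)

section \<open>Homotopy invariance\<close>

lemma homotopic_morphisms_GL0_reachable:
  assumes "homotopic_morphisms f g" "a \<in> Lg m"
  shows "GL0_reachable m (\<lambda>i. f (a i)) (\<lambda>i. g (a i)) \<and> GL0_reachable m (\<lambda>i. g (a i)) (\<lambda>i. f (a i))"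
proof -
  obtain h where h: "\<And>t. t \<in> {0..1::real} \<Longrightarrow> banach_morphism (h t)"
      "\<And>x. continuous_on {0..1} (\<lambda>t. h t x)" "h 0 = f" "h 1 = g"
    using assms(1) unfolding homotopic_morphisms_def by blast
  define p where "p = (\<lambda>t i. h t (a i))"
  have "continuous_on {0..1} p"
    unfolding p_def by (intro continuous_on_coordinatewise_then_product h)
  then have "connected (p ` {0..1})"
    by (intro connected_continuous_image) auto
  moreover have "p ` {0..1} \<subseteq> Lg m"
    unfolding p_def using morphism_Lg[OF h(1) assms(2)] by (rule image_subsetI)
  moreover have "(\<lambda>i. f (a i)) \<in> p ` {0..1}"
    by (rule image_eqI[of _ _ 0]) (simp_all add: p_def h)
  moreover have "(\<lambda>i. g (a i)) \<in> p ` {0..1}"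
    by (rule image_eqI[of _ _ 1]) (simp_all add: p_def h)
  ultimately show ?thesis
    using connected_Lg_GL0_reachable by blast
qed

text \<open>
  The argument runs alike for \<open>GL\<close> and \<open>GL\<^sup>0\<close>: all it uses of the acting families \<open>G\<close>, \<open>H\<close> is
  that \<open>f\<close> maps one into the other and that the target is stable under multiplication by
  \<open>GL\<^sup>0\<close>, which absorbs the two ends of the homotopy.
\<close>

lemma acts_transitively_transfer:
  fixes f :: "'a::complex_banach_algebra_1 \<Rightarrow> 'b::complex_banach_algebra_1"
  assumes f: "banach_morphism f" and g: "banach_morphism g"
    and fg: "homotopic_morphisms (f \<circ> g) id"
    and G: "acts_transitively m G (Lg m)"
    and fG: "\<And>\<alpha>. \<alpha> \<in> G \<Longrightarrow> (\<lambda>i j. f (\<alpha> i j)) \<in> H"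
    and H: "\<And>\<alpha> \<beta> \<gamma>. \<lbrakk>\<alpha> \<in> GL0 m; \<beta> \<in> H; \<gamma> \<in> GL0 m\<rbrakk>
              \<Longrightarrow> matrix_times m \<alpha> (matrix_times m \<beta> \<gamma>) \<in> H"
  shows "acts_transitively m H (Lg m)"
  unfolding acts_transitively_def
proof (intro ballI)
  fix a b :: "nat \<Rightarrow> 'b" assume a: "a \<in> Lg m" and b: "b \<in> Lg m"
  obtain \<alpha> where \<alpha>: "\<alpha> \<in> G" "matrix_act m \<alpha> (\<lambda>i. g (a i)) = (\<lambda>i. g (b i))"
    using G morphism_Lg[OF g a] morphism_Lg[OF g b] unfolding acts_transitively_def by blast
  have \<beta>: "matrix_act m (\<lambda>i j. f (\<alpha> i j)) (\<lambda>i. f (g (a i))) = (\<lambda>i. f (g (b i)))"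
    using morphism_matrix_act[OF f, of m \<alpha> "\<lambda>i. g (a i)"] by (simp add: \<alpha>(2))
  obtain \<gamma> where \<gamma>: "\<gamma> \<in> GL0 m" "matrix_act m \<gamma> a = (\<lambda>i. f (g (a i)))"
    using homotopic_morphisms_GL0_reachable[OF fg a] by (auto simp: GL0_reachable_def)
  obtain \<delta> where \<delta>: "\<delta> \<in> GL0 m" "matrix_act m \<delta> (\<lambda>i. f (g (b i))) = b"
    using homotopic_morphisms_GL0_reachable[OF fg b] by (auto simp: GL0_reachable_def)
  have "matrix_act m (matrix_times m \<delta> (matrix_times m (\<lambda>i j. f (\<alpha> i j)) \<gamma>)) a = b"
    by (simp add: matrix_act_times \<beta> \<gamma> \<delta>)
  then show "\<exists>\<alpha>\<in>H. matrix_act m \<alpha> a = b"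
    using H[OF \<delta>(1) fG[OF \<alpha>(1)] \<gamma>(1)] by blast
qed

lemma transitive_transfer_GL:
  fixes f :: "'a::complex_banach_algebra_1 \<Rightarrow> 'b::complex_banach_algebra_1"
  assumes "banach_morphism f" "banach_morphism g" "homotopic_morphisms (f \<circ> g) id"
    and "acts_transitively m (GL m) (Lg m :: (nat \<Rightarrow> 'a) set)"
  shows "acts_transitively m (GL m) (Lg m :: (nat \<Rightarrow> 'b) set)"
  using assms(4) morphism_GL[OF assms(1)]
  by (rule acts_transitively_transfer[OF assms(1-3)]) (use GL0_subset_GL GL_times in blast)+

lemma transitive_transfer_GL0:
  fixes f :: "'a::complex_banach_algebra_1 \<Rightarrow> 'b::complex_banach_algebra_1"
  assumes "banach_morphism f" "banach_morphism g" "homotopic_morphisms (f \<circ> g) id"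
    and "acts_transitively m (GL0 m) (Lg m :: (nat \<Rightarrow> 'a) set)"
  shows "acts_transitively m (GL0 m) (Lg m :: (nat \<Rightarrow> 'b) set)"
  using assms(4) morphism_GL0[OF assms(1)]
  by (rule acts_transitively_transfer[OF assms(1-3)]) (use GL0_times in blast)+

theorem theorem4p1:
  assumes "homotopy_equivalent_algebras TYPE('a::complex_banach_algebra_1)
             TYPE('b::complex_banach_algebra_1)"
  shows "csr TYPE('a) = csr TYPE('b) \<and> gsr TYPE('a) = gsr TYPE('b)"
proof -
  obtain f :: "'a \<Rightarrow> 'b" and g :: "'b \<Rightarrow> 'a" where fg:
      "banach_morphism f" "banach_morphism g"
      "homotopic_morphisms (g \<circ> f) id" "homotopic_morphisms (f \<circ> g) id"
    using assms unfolding homotopy_equivalent_algebras_def by blast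
  have "acts_transitively m (GL m) (Lg m :: (nat \<Rightarrow> 'a) set) \<longleftrightarrow>
        acts_transitively m (GL m) (Lg m :: (nat \<Rightarrow> 'b) set)" for m
    using transitive_transfer_GL[OF fg(1,2,4)] transitive_transfer_GL[OF fg(2,1,3)] by (rule iffI)
  moreover have "acts_transitively m (GL0 m) (Lg m :: (nat \<Rightarrow> 'a) set) \<longleftrightarrow>
        acts_transitively m (GL0 m) (Lg m :: (nat \<Rightarrow> 'b) set)" for m
    using transitive_transfer_GL0[OF fg(1,2,4)] transitive_transfer_GL0[OF fg(2,1,3)] by (rule iffI)
  ultimately show ?thesis
    by (simp add: csr_def gsr_def)
qed

end
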